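(* A graph class $\mathcal{G}$ is nowhere dense if and only if there exists a function $n^*_0:\mathbb{R}\times\mathbb{N}\to\mathbb{N}$ such that for every subgraph $H$ of a graph $G\in\mathcal{G}$ there exists an ordering $\sigma^*(H)$ of $H$ such that for all $\epsilon>0$ and $r\in\mathbb{N}$, if $|H|\ge n^*_0(\epsilon,r)$, then $\operatorname{scol}_r(H,\sigma^*(H))\le|H|^\epsilon$.
   Context: All graphs $G=(V,E)$ are finite, simple and undirected; $|G|$ denotes the number of vertices of $G$. $\mathbb{N}$ denotes the positive integers. An ordering $\sigma$ of $G$ is a total ordering $<_\sigma$ of its vertex set $V$; $\Pi(G)$ denotes the set of all orderings of $G$. For $r\in\mathbb{N}$, $\sigma\in\Pi(G)$ and $x\in V$, a vertex $y$ is strongly $r$-reachable from $x$ with respect to $\sigma$ if $y\le_\sigma x$ and there is a path $P$ in $G$ from $x$ to $y$ with at most $r$ edges such that every vertex $p\in V(P)\setminus\{y\}$ satisfies $p\ge_\sigma x$. Let $S_r[G,\sigma,x]$ be the set of vertices strongly $r$-reachable from $x$ (it contains $x$ itself). Define $\operatorname{scol}_r(G,\sigma)=\max_{x\in V}|S_r[G,\sigma,x]|$ and $\operatorname{scol}_r(G)=\min_{\sigma\in\Pi(G)}\operatorname{scol}_r(G,\sigma)$. Definition of nowhere dense used here: a graph class $\mathcal{G}$ is nowhere dense if and only if there exists a function $n_0:\mathbb{R}\times\mathbb{N}\to\mathbb{N}$ such that for every $\epsilon>0$, $r\in\mathbb{N}$ and $G\in\mathcal{G}$ we have $\operatorname{scol}_r(H)\le|H|^\epsilon$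 for all subgraphs $H$ of $G$ with $|H|\ge n_0(\epsilon,r)$. *)

theory Defs
  imports Complex_Main "HOL-Library.FuncSet" "Graph_Theory.Graph_Theory"
begin

text \<open>
  A finite, simple, undirected graph is a \<open>pair_graph\<close>: a finite loop-free digraph with a
  symmetric arc relation, so that every edge is represented by its two orientations.
  An ordering \<open>\<sigma>\<close> is a reflexive linear order; \<open>(u, v) \<in> \<sigma>\<close> means \<open>u \<le> v\<close>.
\<close>

definition orderings :: "'a pair_pre_digraph \<Rightarrow> 'a rel set" where
  "orderings G = {\<sigma>. linear_order_on (pverts G) \<sigma>}"

text \<open>The library relation \<open>subgraph\<close> alone would also admit non-symmetric sub-digraphs.\<close>

definition subgraphs :: "'a pair_pre_digraph \<Rightarrow> 'a pair_pre_digraph set" where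
  "subgraphs G = {H. pair_graph H \<and> subgraph (with_proj H) (with_proj G)}"

definition strongly_reachable ::
    "nat \<Rightarrow> 'a pair_pre_digraph \<Rightarrow> 'a rel \<Rightarrow> 'a \<Rightarrow> 'a set" where
  "strongly_reachable r G \<sigma> x =
     {y. (y, x) \<in> \<sigma> \<and>
         (\<exists>p. vpath p (with_proj G) \<and> hd p = x \<and> last p = y \<and> vwalk_length p \<le> r \<and>
              (\<forall>v \<in> set p - {y}. (x, v) \<in> \<sigma>))}"

text \<open>
  The maximum below is over an empty set, hence unspecified, for the graph without vertices.
  Thresholds are therefore required to be positive, as \<open>\<nat>\<close> denotes the positive integers.
\<close>

definition scol_ord :: "nat \<Rightarrow> 'a pair_pre_digraph \<Rightarrow> 'a rel \<Rightarrow> nat" where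
  "scol_ord r G \<sigma> = Max ((\<lambda>x. card (strongly_reachable r G \<sigma> x)) ` pverts G)"

definition scol :: "nat \<Rightarrow> 'a pair_pre_digraph \<Rightarrow> nat" where
  "scol r G = Min (scol_ord r G ` orderings G)"

definition nowhere_dense :: "'a pair_pre_digraph set \<Rightarrow> bool" where
  "nowhere_dense \<G> \<longleftrightarrow>
     (\<exists>n\<^sub>0 \<in> (UNIV :: real set) \<times> {1::nat..} \<rightarrow> {1::nat..}.
        \<forall>\<epsilon>>0. \<forall>r\<ge>1. \<forall>G\<in>\<G>. \<forall>H\<in>subgraphs G.
          card (pverts H) \<ge> n\<^sub>0 (\<epsilon>, r) \<longrightarrow>
            real (scol r H) \<le> real (card (pverts H)) powr \<epsilon>)"

end

theory Submission
  imports Defs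
begin

text \<open>
  For a fixed ordering the strong colouring number is monotone in the radius, so a diagonal
  argument suffices. With \<open>k\<close> the largest number for which \<open>H\<close> is above the threshold of
  \<open>(1/k, k)\<close>, an ordering of \<open>H\<close> that is optimal for radius \<open>k\<close> serves all \<open>(\<epsilon>, r)\<close> with
  \<open>1/k \<le> \<epsilon>\<close> and \<open>r \<le> k\<close> at once. The bound \<open>k \<le> |H|\<close> ensures that \<open>k\<close> exists.
\<close>

lemma finite_orderings:
  assumes "finite (pverts G)"
  shows "finite (orderings G)"
proof (rule finite_subset)
  show "orderings G \<subseteq> Pow (pverts G \<times> pverts G)"
    by (auto simp: orderings_def order_on_defs)
  show "finite (Pow (pverts G \<times> pverts G))"
    using assms by simp
qed

lemma orderings_nonempty: "orderings G \<noteq> {}"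
proof -
  obtain r where "well_order_on (pverts G) r"
    using well_order_on by blast
  then show ?thesis
    by (auto simp: orderings_def well_order_on_def)
qed

lemma scol_le_scol_ord:
  assumes "finite (pverts G)" "\<sigma> \<in> orderings G"
  shows "scol r G \<le> scol_ord r G \<sigma>"
  using assms by (simp add: scol_def finite_orderings)

lemma scol_attained:
  assumes "finite (pverts G)"
  obtains \<sigma> where "\<sigma> \<in> orderings G" "scol_ord r G \<sigma> = scol r G"
proof -
  have "scol r G \<in> scol_ord r G ` orderings G"
    unfolding scol_def using assms
    by (intro Min_in) (simp_all add: finite_orderings orderings_nonempty)
  then show thesis
    using that by auto
qed

text \<open>A path with at most \<open>r\<close> edges also has at most \<open>s\<close>, so every
  reachable set can only grow with the radius. \<open>ne\<close> keeps both maxima from ranging over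
  the empty set.\<close>

lemma scol_ord_mono:
  assumes fin: "finite (pverts G)" and ne: "pverts G \<noteq> {}"
    and \<sigma>: "\<sigma> \<in> orderings G" and "r \<le> s"
  shows "scol_ord r G \<sigma> \<le> scol_ord s G \<sigma>"
proof -
  have "card (strongly_reachable r G \<sigma> x) \<le> scol_ord s G \<sigma>" if x: "x \<in> pverts G" for x
  proof -
    have "strongly_reachable s G \<sigma> x \<subseteq> pverts G"
      using \<sigma> by (auto simp: strongly_reachable_def orderings_def order_on_defs)
    then have "finite (strongly_reachable s G \<sigma> x)"
      using fin finite_subset by blast
    moreover have "strongly_reachable r G \<sigma> x \<subseteq> strongly_reachable s G \<sigma> x"
      using \<open>r \<le> s\<close> unfolding strongly_reachable_def by (blast intro: order_trans)
    ultimately have "card (strongly_reachable r G \<sigma> x) \<le> card (strongly_reachable s G \<sigma> x)"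
      by (rule card_mono)
    also have "\<dots> \<le> scol_ord s G \<sigma>"
      unfolding scol_ord_def using fin x by simp
    finally show ?thesis .
  qed
  then show ?thesis
    using fin ne by (simp add: scol_ord_def[of r])
qed

lemma finite_pverts_subgraphs: "H \<in> subgraphs G \<Longrightarrow> finite (pverts H)"
  by (simp add: subgraphs_def pair_graph_def pair_digraph_def pair_fin_digraph.pair_finite_verts)

theorem corollary1p6:
  fixes \<G> :: "'a pair_pre_digraph set"
  assumes "\<forall>G\<in>\<G>. pair_graph G"
  shows "nowhere_dense \<G> \<longleftrightarrow>
     (\<exists>n\<^sub>0 \<in> (UNIV :: real set) \<times> {1::nat..} \<rightarrow> {1::nat..}.
        \<forall>G\<in>\<G>. \<forall>H\<in>subgraphs G. \<exists>\<sigma>\<in>orderings H.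
          \<forall>\<epsilon>>0. \<forall>r\<ge>1. card (pverts H) \<ge> n\<^sub>0 (\<epsilon>, r) \<longrightarrow>
            real (scol_ord r H \<sigma>) \<le> real (card (pverts H)) powr \<epsilon>)"
  (is "_ \<longleftrightarrow> ?uniform")
proof
  assume "nowhere_dense \<G>"
  then obtain n\<^sub>0 :: "real \<times> nat \<Rightarrow> nat" where
    bound: "\<And>\<epsilon> r G H. \<lbrakk>\<epsilon> > 0; r \<ge> 1; G \<in> \<G>; H \<in> subgraphs G; card (pverts H) \<ge> n\<^sub>0 (\<epsilon>, r)\<rbrakk>
      \<Longrightarrow> real (scol r H) \<le> real (card (pverts H)) powr \<epsilon>"
    unfolding nowhere_dense_def by blast
  \<comment> \<open>For \<epsilon> > 0 and r \<ge> 1 this is the least \<open>k\<close> with r \<le>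
    k and 1/k \<le> \<epsilon>.\<close>
  define index where "index = (\<lambda>(\<epsilon>::real, r). max r (nat \<lceil>1 / \<epsilon>\<rceil>))"
  \<comment> \<open>Above this threshold both conditions for \<open>index p\<close> to lie in the
    set \<open>K\<close> below hold: it is at most the order of \<open>H\<close>, and
    \<open>H\<close> is large enough for \<open>n\<^sub>0\<close> at that index.\<close>
  define n\<^sub>1 where "n\<^sub>1 = (\<lambda>p. max (index p) (n\<^sub>0 (1 / real (index p), index p)))"
  have "n\<^sub>1 \<in> UNIV \<times> {1..} \<rightarrow> {1..}"
    by (auto simp: n\<^sub>1_def index_def le_max_iff_disj)
  moreover have "\<exists>\<sigma>\<in>orderings H. \<forall>\<epsilon>>0. \<forall>r\<ge>1. card (pverts H) \<ge> n\<^sub>1 (\<epsilon>, r) \<longrightarrow>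
      real (scol_ord r H \<sigma>) \<le> real (card (pverts H)) powr \<epsilon>"
    if G: "G \<in> \<G>" and H: "H \<in> subgraphs G" for G H
  proof -
    let ?n = "card (pverts H)"
    \<comment> \<open>\<open>K\<close> depends on \<open>H\<close> alone, so the ordering is fixed
      before \<epsilon> and \<open>r\<close> are given.\<close>
    define K where "K = {k. 1 \<le> k \<and> k \<le> ?n \<and> n\<^sub>0 (1 / real k, k) \<le> ?n}"
    have finK: "finite K"
      by (rule finite_subset[of _ "{..?n}"]) (auto simp: K_def)
    have fin: "finite (pverts H)"
      using H by (rule finite_pverts_subgraphs)
    \<comment> \<open>If \<open>K\<close> is empty, \<open>Max K\<close> is unspecified, but any
      ordering then works: no admissible pair meets its threshold, as that would put its index into
      \<open>K\<close>.\<close>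
    obtain \<sigma> where \<sigma>: "\<sigma> \<in> orderings H" "scol_ord (Max K) H \<sigma> = scol (Max K) H"
      using scol_attained[OF fin] .
    have "real (scol_ord r H \<sigma>) \<le> real ?n powr \<epsilon>"
      if "\<epsilon> > 0" "r \<ge> 1" "?n \<ge> n\<^sub>1 (\<epsilon>, r)" for \<epsilon> :: real and r
    proof -
      have indexK: "index (\<epsilon>, r) \<in> K"
        using that by (auto simp: K_def n\<^sub>1_def index_def)
      then have MaxK: "Max K \<in> K" and le: "index (\<epsilon>, r) \<le> Max K"
        using finK Max_in by auto
      have pos: "?n \<ge> 1" "Max K \<ge> 1" and le_n: "n\<^sub>0 (1 / real (Max K), Max K) \<le> ?n"
        using MaxK by (auto simp: K_def)
      have "r \<le> Max K" and "1 / \<epsilon> \<le> real (Max K)"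
        using le by (simp_all add: index_def nat_le_iff ceiling_le_iff)
      then have eps: "1 / real (Max K) \<le> \<epsilon>"
        using \<open>\<epsilon> > 0\<close> pos by (simp add: field_simps)
      have "pverts H \<noteq> {}"
        using pos by auto
      then have "real (scol_ord r H \<sigma>) \<le> real (scol (Max K) H)"
        using scol_ord_mono[OF fin _ \<sigma>(1) \<open>r \<le> Max K\<close>] \<sigma>(2) by simp
      also have "\<dots> \<le> real ?n powr (1 / real (Max K))"
        using bound[OF _ _ G H le_n] pos by simp
      \<comment> \<open>Raising the exponent is monotone because the base is at least 1.\<close>
      also have "\<dots> \<le> real ?n powr \<epsilon>"
        using eps pos by (intro powr_mono) simp_all
      finally show ?thesis .
    qed
    then show ?thesis
      using \<sigma>(1) by blast
  qed
  ultimately show ?uniform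
    by blast
next
  assume ?uniform
  \<comment> \<open>The same threshold function works, since \<open>scol\<close> is a minimum over
    all orderings and so lies below the value at the given one.\<close>
  then show "nowhere_dense \<G>"
    unfolding nowhere_dense_def
    by (meson finite_pverts_subgraphs of_nat_mono order_trans scol_le_scol_ord)
qed

end
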